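(* Let $\mathcal A\subseteq\mathbb N$, $L$ an environment, $x$ a variable and $W,T$ terms. Then $L\vdash_{\mathcal A}\lambda x{:}W.\,T:W$ does not hold.
   Context: Fix a nonempty set $\Sigma$ of sorts with decidable equality, an arbitrary function $\mathrm{next}:\Sigma\to\Sigma$, and a countably infinite set of variables. Terms and environments: $T,U,V,W ::= \star s \mid x \mid \mathrm{app}(V,T) \mid \lambda x{:}W.\,T \mid \mathrm{def}(x{=}V).\,T \mid \mathrm{cast}(U,T)$ ($s\in\Sigma$) and $L,K ::= \emptyset \mid K,x{:}W \mid K,x{=}V$. $\mathrm{app}(V,T)$ applies $T$ to $V$; $\lambda x{:}W.\,T$ (de Bruijn's abstraction) and $\mathrm{def}(x{=}V).\,T$ (local definition) bind $x$ in $T$; $\mathrm{cast}(U,T)$ annotates $T$ with expected type $U$; entries $x{:}W$ and $x{=}V$ bind $x$. Terms are modulo renaming of bound variables. Write $\mathsf{B}x[V]$ for either $\lambda x{:}V$ or $\mathrm{def}(x{=}V)$ and correspondingly $L,x[V]$ for $L,x{:}V$ resp. $L,x{=}V$. One step of bound rt-reduction $L\vdash T_1\to^nT_2$ is the smallest relation closed under: $L\vdash\mathrm{app}(V,\lambda x{:}W.\,T)\to^0\mathrm{def}(x{=}\mathrm{cast}(W,V)).\,T$; $K,x{=}V\vdash x\to^0V$; $L\vdash\mathrm{def}(x{=}V).\,T\to^0T$ if $x$ not free in $T$; $L\vdash\mathrm{app}(V,\mathrm{def}(x{=}W).\,T)\to^0\mathrm{def}(x{=}W).\,\mathrm{app}(V,T)$;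 $L\vdash\mathrm{cast}(U,T)\to^0T$; $L\vdash\star s\to^1\star\,\mathrm{next}(s)$; $K,x{:}W\vdash x\to^1W$; $L\vdash\mathrm{cast}(U,T)\to^1U$; if $K\vdash x\to^nT$, $y\neq x$, $y$ not free in $T$ then $K,y[V]\vdash x\to^nT$; if $L\vdash V_1\to^0V_2$ then $L\vdash\mathrm{app}(V_1,T)\to^0\mathrm{app}(V_2,T)$; if $L\vdash T_1\to^nT_2$ then $L\vdash\mathrm{app}(V,T_1)\to^n\mathrm{app}(V,T_2)$; if $L\vdash V_1\to^0V_2$ then $L\vdash\mathsf Bx[V_1].\,T\to^0\mathsf Bx[V_2].\,T$; if $L,x[V]\vdash T_1\to^nT_2$ then $L\vdash\mathsf Bx[V].\,T_1\to^n\mathsf Bx[V].\,T_2$; if $L\vdash U_1\to^0U_2$ then $L\vdash\mathrm{cast}(U_1,T)\to^0\mathrm{cast}(U_2,T)$; if $L\vdash T_1\to^0T_2$ then $L\vdash\mathrm{cast}(U,T_1)\to^0\mathrm{cast}(U,T_2)$; if $L\vdash U_1\to^1U_2$ and $L\vdash T_1\to^1T_2$ then $L\vdash\mathrm{cast}(U_1,T_1)\to^1\mathrm{cast}(U_2,T_2)$. $L\vdash T_1\to^{*n}T_2$ is the smallest relation with $L\vdash T\to^{*0}T$, containing single steps, and with $L\vdash T_1\to^{*n_1}T$, $L\vdash T\to^{*n_2}T_2$ implying $L\vdash T_1\to^{*n_1+n_2}T_2$. Validity $L\vdash_{\mathcal A}T$ is the smallest predicate closed under: $L\vdash_{\mathcal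 A}\star s$; if $K\vdash_{\mathcal A}V$ then $K,x[V]\vdash_{\mathcal A}x$; if $K\vdash_{\mathcal A}x$ and $y\neq x$ then $K,y[V]\vdash_{\mathcal A}x$; if $L\vdash_{\mathcal A}V$ and $L,x[V]\vdash_{\mathcal A}T$ then $L\vdash_{\mathcal A}\mathsf Bx[V].\,T$; if $L\vdash_{\mathcal A}U$, $L\vdash_{\mathcal A}T$ and some $U_0$ satisfies $L\vdash T\to^{*1}U_0$, $L\vdash U\to^{*0}U_0$, then $L\vdash_{\mathcal A}\mathrm{cast}(U,T)$; if $L\vdash_{\mathcal A}V$, $L\vdash_{\mathcal A}T$ and there are $n\in\mathcal A$, $x,W_0,U_0$ with $L\vdash T\to^{*n}\lambda x{:}W_0.\,U_0$ and $L\vdash V\to^{*1}W_0$, then $L\vdash_{\mathcal A}\mathrm{app}(V,T)$. The type judgment $L\vdash_{\mathcal A}T:U$ means $L\vdash_{\mathcal A}\mathrm{cast}(U,T)$. *)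

theory Defs
  imports Main
begin

text \<open>
  Terms modulo renaming of bound variables are represented with de Bruijn indices, and an
  environment is a list whose head is its most recent (innermost) entry.  The index \<open>i\<close>
  refers to the \<open>i\<close>-th enclosing binder, counting first the binders of the term and then the
  entries of the environment; an index beyond all of these is a variable free in the closure.
  Hence the variable bound by the head entry of \<open>e # K\<close> is \<open>Var 0\<close>, the variable \<open>Var i\<close>
  of \<open>K\<close> is \<open>Var (Suc i)\<close> in \<open>e # K\<close>, and a term \<open>T\<close> over \<open>K\<close> reads \<open>lift 0 T\<close> over
  \<open>e # K\<close>.  The sorts are the elements of the type \<open>'s\<close>.
\<close>

datatype bkind = Abst | Abbr

datatype 's trm =
    Sort 's
  | Var nat
  | App "'s trm" "'s trm"
  | Bind bkind "'s trm" "'s trm"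
  | Cast "'s trm" "'s trm"

text \<open>As in the notation \<open>app(V,T)\<close>, the first component of \<open>App V T\<close> is the argument; in
  \<open>Cast U T\<close> the first component is the expected type.\<close>

abbreviation Lam :: "'s trm \<Rightarrow> 's trm \<Rightarrow> 's trm" where
  "Lam W T \<equiv> Bind Abst W T"

abbreviation Def :: "'s trm \<Rightarrow> 's trm \<Rightarrow> 's trm" where
  "Def V T \<equiv> Bind Abbr V T"

type_synonym 's env = "(bkind \<times> 's trm) list"

text \<open>The terms of the form \<open>lift k T\<close> are exactly those in which the variable \<open>k\<close> is not free
  (\<open>range_lift\<close> below).\<close>

primrec lift :: "nat \<Rightarrow> 's trm \<Rightarrow> 's trm" where
  "lift k (Sort s) = Sort s"
| "lift k (Var i) = Var (if i < k then i else Suc i)"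
| "lift k (App V T) = App (lift k V) (lift k T)"
| "lift k (Bind b V T) = Bind b (lift k V) (lift (Suc k) T)"
| "lift k (Cast U T) = Cast (lift k U) (lift k T)"

primrec free_in :: "nat \<Rightarrow> 's trm \<Rightarrow> bool" where
  "free_in k (Sort s) \<longleftrightarrow> False"
| "free_in k (Var i) \<longleftrightarrow> i = k"
| "free_in k (App V T) \<longleftrightarrow> free_in k V \<or> free_in k T"
| "free_in k (Bind b V T) \<longleftrightarrow> free_in k V \<or> free_in (Suc k) T"
| "free_in k (Cast U T) \<longleftrightarrow> free_in k U \<or> free_in k T"

lemma free_in_lift: "\<not> free_in k (lift k T)"
  by (induction T arbitrary: k) auto

lemma lift_of_not_free: "\<not> free_in k T \<Longrightarrow> \<exists>T'. T = lift k T'"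
proof (induction T arbitrary: k)
  case (Sort s)
  show ?case by (rule exI[of _ "Sort s"]) simp
next
  case (Var i)
  then show ?case
    by (intro exI[of _ "Var (if i < k then i else i - 1)"]) auto
next
  case (App V T)
  then show ?case by (metis free_in.simps(3) lift.simps(3))
next
  case (Bind b V T)
  then show ?case by (metis free_in.simps(4) lift.simps(4))
next
  case (Cast U T)
  then show ?case by (metis free_in.simps(5) lift.simps(5))
qed

lemma range_lift: "range (lift k) = {T. \<not> free_in k T}"
  using free_in_lift lift_of_not_free by blast

text \<open>
  \<open>rt_step nxt n L T1 T2\<close> is one step \<open>L \<turnstile> T1 \<rightarrow>\<^sup>n T2\<close> of bound rt-reduction, where \<open>nxt\<close> is the
  function on sorts.  In \<open>zeta\<close> the side condition "\<open>x\<close> not free in the body" is the shape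
  \<open>lift 0 T\<close> of the body; in \<open>lref\<close> the new entry's variable does not occur in \<open>lift 0 T\<close>;
  in \<open>theta\<close> the lifting prevents the capture of variables of \<open>V\<close>.
\<close>

inductive rt_step :: "('s \<Rightarrow> 's) \<Rightarrow> nat \<Rightarrow> 's env \<Rightarrow> 's trm \<Rightarrow> 's trm \<Rightarrow> bool"
  for nxt :: "'s \<Rightarrow> 's" where
  beta: "rt_step nxt 0 L (App V (Lam W T)) (Def (Cast W V) T)"
| delta: "rt_step nxt 0 ((Abbr, V) # K) (Var 0) (lift 0 V)"
| zeta: "rt_step nxt 0 L (Def V (lift 0 T)) T"
| theta: "rt_step nxt 0 L (App V (Def W T)) (Def W (App (lift 0 V) T))"
| eps: "rt_step nxt 0 L (Cast U T) T"
| sort: "rt_step nxt 1 L (Sort s) (Sort (nxt s))"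
| ldef: "rt_step nxt 1 ((Abst, W) # K) (Var 0) (lift 0 W)"
| ee: "rt_step nxt 1 L (Cast U T) U"
| lref: "rt_step nxt n K (Var i) T \<Longrightarrow> rt_step nxt n ((b, V) # K) (Var (Suc i)) (lift 0 T)"
| app_l: "rt_step nxt 0 L V1 V2 \<Longrightarrow> rt_step nxt 0 L (App V1 T) (App V2 T)"
| app_r: "rt_step nxt n L T1 T2 \<Longrightarrow> rt_step nxt n L (App V T1) (App V T2)"
| bind_l: "rt_step nxt 0 L V1 V2 \<Longrightarrow> rt_step nxt 0 L (Bind b V1 T) (Bind b V2 T)"
| bind_r: "rt_step nxt n ((b, V) # L) T1 T2 \<Longrightarrow> rt_step nxt n L (Bind b V T1) (Bind b V T2)"
| cast_l: "rt_step nxt 0 L U1 U2 \<Longrightarrow> rt_step nxt 0 L (Cast U1 T) (Cast U2 T)"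
| cast_r: "rt_step nxt 0 L T1 T2 \<Longrightarrow> rt_step nxt 0 L (Cast U T1) (Cast U T2)"
| cast_lr: "rt_step nxt 1 L U1 U2 \<Longrightarrow> rt_step nxt 1 L T1 T2 \<Longrightarrow>
    rt_step nxt 1 L (Cast U1 T1) (Cast U2 T2)"

inductive rt_steps :: "('s \<Rightarrow> 's) \<Rightarrow> nat \<Rightarrow> 's env \<Rightarrow> 's trm \<Rightarrow> 's trm \<Rightarrow> bool"
  for nxt :: "'s \<Rightarrow> 's" where
  refl: "rt_steps nxt 0 L T T"
| step: "rt_step nxt n L T1 T2 \<Longrightarrow> rt_steps nxt n L T1 T2"
| trans: "rt_steps nxt n1 L T1 T \<Longrightarrow> rt_steps nxt n2 L T T2 \<Longrightarrow> rt_steps nxt (n1 + n2) L T1 T2"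

inductive valid :: "('s \<Rightarrow> 's) \<Rightarrow> nat set \<Rightarrow> 's env \<Rightarrow> 's trm \<Rightarrow> bool"
  for nxt :: "'s \<Rightarrow> 's" and A :: "nat set" where
  sort: "valid nxt A L (Sort s)"
| zero: "valid nxt A K V \<Longrightarrow> valid nxt A ((b, V) # K) (Var 0)"
| lref: "valid nxt A K (Var i) \<Longrightarrow> valid nxt A ((b, V) # K) (Var (Suc i))"
| bind: "valid nxt A L V \<Longrightarrow> valid nxt A ((b, V) # L) T \<Longrightarrow> valid nxt A L (Bind b V T)"
| cast: "valid nxt A L U \<Longrightarrow> valid nxt A L T \<Longrightarrow>
    \<exists>U0. rt_steps nxt 1 L T U0 \<and> rt_steps nxt 0 L U U0 \<Longrightarrow> valid nxt A L (Cast U T)"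
| app: "valid nxt A L V \<Longrightarrow> valid nxt A L T \<Longrightarrow>
    \<exists>n\<in>A. \<exists>W0 U0. rt_steps nxt n L T (Lam W0 U0) \<and> rt_steps nxt 1 L V W0 \<Longrightarrow>
    valid nxt A L (App V T)"

definition has_type :: "('s \<Rightarrow> 's) \<Rightarrow> nat set \<Rightarrow> 's env \<Rightarrow> 's trm \<Rightarrow> 's trm \<Rightarrow> bool" where
  "has_type nxt A L T U \<longleftrightarrow> valid nxt A L (Cast U T)"

end

theory Submission
  imports Defs
begin

text \<open>
  Assign to terms simple types (each called an arity) built from one base arity by arrows: every
  sort has the base arity, a variable has the arity of its entry (whether declared or defined), and an
  abstraction over \<open>W\<close> has the arity \<open>b \<rightarrow> a\<close> with \<open>b\<close> the arity of \<open>W\<close> itself.  As a term thus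
  has the same arity as its type, the arity is preserved by reduction steps of every bound \<open>n\<close>, so
  a valid \<open>Cast U T\<close> forces \<open>U\<close> and \<open>T\<close> to have the same arity.  For \<open>U = W\<close> and \<open>T = Lam W T'\<close>
  this would give \<open>b = (b \<rightarrow> a)\<close>.
\<close>

datatype arity = Base | Arrow arity arity

lemma Arrow_neq_arg: "b \<noteq> Arrow b a"
proof
  assume "b = Arrow b a"
  then have "size b = size (Arrow b a)" by (rule arg_cong)
  then show False by simp
qed

text \<open>The entry \<open>None\<close> in the list stands for an environment entry without an arity: validity over
  an environment says nothing about the entries that the term does not use.\<close>

primrec arity_of :: "arity option list \<Rightarrow> 's trm \<Rightarrow> arity option" where
  "arity_of G (Sort s) = Some Base"
| "arity_of G (Var i) = (if i < length G then G ! i else None)"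
| "arity_of G (App V T) =
    (case arity_of G T of
      Some (Arrow b a) \<Rightarrow> if arity_of G V = Some b then Some a else None
    | _ \<Rightarrow> None)"
| "arity_of G (Bind k V T) =
    (case arity_of G V of
      None \<Rightarrow> None
    | Some b \<Rightarrow> map_option (case k of Abst \<Rightarrow> Arrow b | Abbr \<Rightarrow> id) (arity_of (Some b # G) T))"
| "arity_of G (Cast U T) = (if arity_of G U = arity_of G T then arity_of G T else None)"

primrec env_arities :: "'s env \<Rightarrow> arity option list" where
  "env_arities [] = []"
| "env_arities (e # K) = arity_of (env_arities K) (snd e) # env_arities K"

lemma arity_of_App_eq_Some:
  "arity_of G (App V T) = Some a \<longleftrightarrow>
    (\<exists>b. arity_of G T = Some (Arrow b a) \<and> arity_of G V = Some b)"
  by (auto split: option.splits arity.splits)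

text \<open>The prefix \<open>G1\<close> lets the induction pass under binders; later only the empty
  prefix matters.\<close>

lemma arity_of_lift:
  "arity_of (G1 @ c # G2) (lift (length G1) T) = arity_of (G1 @ G2) T"
proof (induction T arbitrary: G1)
  case (Var i)
  then show ?case by (auto simp: nth_append Suc_diff_le)
next
  case (App V T)
  then show ?case by (simp cong: option.case_cong arity.case_cong)
next
  case (Bind k V T)
  have "arity_of (Some b # G1 @ c # G2) (lift (Suc (length G1)) T) =
      arity_of (Some b # G1 @ G2) T" for b
    using Bind.IH(2)[of "Some b # G1"] by simp
  then show ?case using Bind.IH(1) by (simp split: option.splits)
qed simp_all

lemma arity_of_lift_0 [simp]: "arity_of (c # G) (lift 0 T) = arity_of G T"
  using arity_of_lift[of "[]"] by simp

text \<open>In \<open>beta\<close>, the declaration of \<open>W\<close> becomes a definition by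
  \<open>Cast W V\<close>, which has the same arity, so the body keeps its arity.\<close>

lemma rt_step_arity_of:
  assumes "rt_step nxt n L T1 T2" and "arity_of (env_arities L) T1 = Some a"
  shows "arity_of (env_arities L) T2 = Some a"
  using assms
proof (induction arbitrary: a)
  case (app_l L V1 V2 T)
  then show ?case unfolding arity_of_App_eq_Some by blast
next
  case (app_r n L T1 T2 V)
  then show ?case unfolding arity_of_App_eq_Some by blast
qed (auto split: option.splits arity.splits if_splits)

lemma rt_steps_arity_of:
  assumes "rt_steps nxt n L T1 T2" and "arity_of (env_arities L) T1 = Some a"
  shows "arity_of (env_arities L) T2 = Some a"
  using assms by induction (auto intro: rt_step_arity_of)

lemma valid_has_arity:
  assumes "valid nxt A L T"
  shows "\<exists>a. arity_of (env_arities L) T = Some a"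
  using assms
proof induction
  case (cast L U T)
  then obtain U0 a b where
    steps: "rt_steps nxt 1 L T U0" "rt_steps nxt 0 L U U0" and
    ars: "arity_of (env_arities L) U = Some a" "arity_of (env_arities L) T = Some b"
    by blast
  have "Some a = Some b"
    using rt_steps_arity_of[OF steps(1) ars(2)] rt_steps_arity_of[OF steps(2) ars(1)] by simp
  then show ?case using ars by simp
next
  case (app L V T)
  then obtain n W0 U0 b a where
    steps: "rt_steps nxt n L T (Lam W0 U0)" "rt_steps nxt 1 L V W0" and
    ars: "arity_of (env_arities L) V = Some b" "arity_of (env_arities L) T = Some a"
    by blast
  \<comment> \<open>Hence the arity of \<open>T\<close>, being that of \<open>Lam W0 U0\<close>, is
    an arrow whose domain \<open>b\<close> is the arity of \<open>V\<close>.\<close>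
  have "arity_of (env_arities L) W0 = Some b" "arity_of (env_arities L) (Lam W0 U0) = Some a"
    using steps ars rt_steps_arity_of by blast+
  then show ?case using ars by (auto split: option.splits)
qed (auto split: if_splits)

theorem theorem5p4:
  fixes nxt :: "'s \<Rightarrow> 's" and A :: "nat set" and L :: "'s env" and W T :: "'s trm"
  shows "\<not> has_type nxt A L (Lam W T) W"
proof
  assume "has_type nxt A L (Lam W T) W"
  then obtain a where "arity_of (env_arities L) (Cast W (Lam W T)) = Some a"
    unfolding has_type_def using valid_has_arity by blast
  then show False using Arrow_neq_arg by (auto split: option.splits if_splits dest!: sym[of "Some _"])
qed

end
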